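(* In the LOCAL model, any distributed $\alpha$-approximation algorithm for weighted TAP requires $\Omega(D)$ rounds (in the worst case over instances whose graph has diameter $D$), where $\alpha\ge 1$ may be any polynomial function of $n$. The same $\Omega(D)$ lower bound holds for unweighted TAP whenever $1\le \alpha<\frac{n-1}{2c}$ for a constant $c>1$.
   Context: LOCAL model: the network is an undirected connected $n$-vertex graph $G$; computation proceeds in synchronous rounds and in each round each vertex may send a message of unbounded size to each neighbour. $D$ denotes the diameter of $G$. Tree Augmentation Problem (TAP): input is a $2$-edge-connected graph $G$ (with non-negative edge weights in the weighted version) and a rooted spanning tree $T$ of $G$, each vertex knowing its incident tree edges and its parent; the output is a set $Aug$ of edges of $G$ with $T\cup Aug$ $2$-edge-connected, each vertex knowing which incident edges are in $Aug$; the objective is to minimize the total weight (weighted) or the number of edges (unweighted) of $Aug$. An $\alpha$-approximation outputs an augmentation of cost at most $\alpha$ times the optimum. *)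

theory Defs
  imports "HOL-Probability.Probability" "HOL-Library.Landau_Symbols"
begin

section \<open>Finite simple undirected graphs\<close>

text \<open>
  The vertices of an $n$-vertex graph are the numbers below $n$, and an undirected edge is a
  two-element set of vertices. A subgraph on the same vertex set is given by its set of edges.
\<close>

definition simple_graph :: "nat \<Rightarrow> nat set set \<Rightarrow> bool" where
  "simple_graph n E \<longleftrightarrow> (\<forall>e\<in>E. \<exists>u v. u < n \<and> v < n \<and> u \<noteq> v \<and> e = {u, v})"

definition adj :: "nat set set \<Rightarrow> (nat \<times> nat) set" where
  "adj E = {(u, v). {u, v} \<in> E}"

definition connected_graph :: "nat \<Rightarrow> nat set set \<Rightarrow> bool" where
  "connected_graph n E \<longleftrightarrow> (\<forall>u<n. \<forall>v<n. (u, v) \<in> (adj E)\<^sup>*)"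

definition two_edge_connected :: "nat \<Rightarrow> nat set set \<Rightarrow> bool" where
  "two_edge_connected n E \<longleftrightarrow> connected_graph n E \<and> (\<forall>e\<in>E. connected_graph n (E - {e}))"

definition is_cycle :: "nat set set \<Rightarrow> nat list \<Rightarrow> bool" where
  "is_cycle E p \<longleftrightarrow> 3 \<le> length p \<and> distinct p \<and>
     (\<forall>i<length p. {p ! i, p ! ((i + 1) mod length p)} \<in> E)"

definition spanning_tree :: "nat \<Rightarrow> nat set set \<Rightarrow> nat set set \<Rightarrow> bool" where
  "spanning_tree n E T \<longleftrightarrow> T \<subseteq> E \<and> connected_graph n T \<and> (\<nexists>p. is_cycle T p)"

text \<open>Only meaningful when \<open>v\<close> is reachable from \<open>u\<close>.\<close>

definition gdist :: "nat set set \<Rightarrow> nat \<Rightarrow> nat \<Rightarrow> nat" where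
  "gdist E u v = (LEAST k. (u, v) \<in> adj E ^^ k)"

definition graph_diameter :: "nat \<Rightarrow> nat set set \<Rightarrow> nat" where
  "graph_diameter n E = Max {gdist E u v | u v. u < n \<and> v < n}"


section \<open>The tree augmentation problem\<close>

record tap =
  vcount :: nat
  edges :: "nat set set"
  weight :: "nat set \<Rightarrow> real"
  tree :: "nat set set"
  root :: nat

definition weighted_tap :: "tap \<Rightarrow> bool" where
  "weighted_tap I \<longleftrightarrow>
     simple_graph (vcount I) (edges I) \<and>
     two_edge_connected (vcount I) (edges I) \<and>
     (\<forall>e\<in>edges I. 0 \<le> weight I e) \<and>
     spanning_tree (vcount I) (edges I) (tree I) \<and>
     root I < vcount I"

text \<open>With unit weights, the weight component carries no information.\<close>

definition unweighted_tap :: "tap \<Rightarrow> bool" where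
  "unweighted_tap I \<longleftrightarrow> weighted_tap I \<and> (\<forall>e\<in>edges I. weight I e = 1)"

definition is_augmentation :: "tap \<Rightarrow> nat set set \<Rightarrow> bool" where
  "is_augmentation I Aug \<longleftrightarrow>
     Aug \<subseteq> edges I \<and> two_edge_connected (vcount I) (tree I \<union> Aug)"

definition total_weight :: "tap \<Rightarrow> nat set set \<Rightarrow> real" where
  "total_weight I Aug = (\<Sum>e\<in>Aug. weight I e)"

definition edge_count :: "tap \<Rightarrow> nat set set \<Rightarrow> real" where
  "edge_count I Aug = real (card Aug)"

definition optimum :: "(tap \<Rightarrow> nat set set \<Rightarrow> real) \<Rightarrow> tap \<Rightarrow> real" where
  "optimum cost I = Min (cost I ` {Aug. is_augmentation I Aug})"

definition diameter_of :: "tap \<Rightarrow> nat" where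
  "diameter_of I = graph_diameter (vcount I) (edges I)"

text \<open>The neighbour of \<open>v\<close> in the tree that is one step closer to the root.\<close>

definition parent :: "tap \<Rightarrow> nat \<Rightarrow> nat option" where
  "parent I v =
     (if v = root I then None
      else Some (THE u. {u, v} \<in> tree I \<and>
                        gdist (tree I) (root I) v = Suc (gdist (tree I) (root I) u)))"


section \<open>Algorithms in the LOCAL model\<close>

text \<open>
  Initially a vertex knows its own name, the number of vertices, the names of its neighbours,
  the weights of its incident edges, its incident tree edges and its parent. The names are
  unique identifiers. Restricting them to the numbers below $n$ and revealing $n$ only makes
  the task of an algorithm easier.
\<close>

record local_input =
  in_count :: nat
  in_name :: nat
  in_nbrs :: "nat set"
  in_weight :: "nat \<Rightarrow> real"
  in_tree_nbrs :: "nat set"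
  in_parent :: "nat option"

definition local_input_of :: "tap \<Rightarrow> nat \<Rightarrow> local_input" where
  "local_input_of I v =
     \<lparr> in_count = vcount I,
       in_name = v,
       in_nbrs = {u. {v, u} \<in> edges I},
       in_weight = (\<lambda>u. if {v, u} \<in> edges I then weight I {v, u} else 0),
       in_tree_nbrs = {u. {v, u} \<in> tree I},
       in_parent = parent I v \<rparr>"

text \<open>
  States, messages and random tapes range over arbitrary types, so neither local computation nor
  message size is bounded. \<open>send s u\<close> is the message (if any) that a vertex in state \<open>s\<close> sends to its
  neighbour \<open>u\<close>; the second argument of \<open>step\<close> gives the message (if any) received from each
  neighbour. \<open>decision s\<close> is \<open>None\<close> as long as the vertex is undecided, and otherwise the set of those
  neighbours that are joined to it by an edge of the computed augmentation.
\<close>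

record ('s, 'm, 'r) local_algorithm =
  init :: "local_input \<Rightarrow> 'r \<Rightarrow> 's"
  send :: "'s \<Rightarrow> nat \<Rightarrow> 'm option"
  step :: "'s \<Rightarrow> (nat \<Rightarrow> 'm option) \<Rightarrow> 's"
  decision :: "'s \<Rightarrow> nat set option"

text \<open>A vertex that has announced its output may still relay messages, but not revise the output.\<close>

definition irrevocable :: "('s, 'm, 'r) local_algorithm \<Rightarrow> bool" where
  "irrevocable A \<longleftrightarrow>
     (\<forall>s inbox X. decision A s = Some X \<longrightarrow> decision A (step A s inbox) = Some X)"

primrec state_after ::
  "('s, 'm, 'r) local_algorithm \<Rightarrow> tap \<Rightarrow> (nat \<Rightarrow> 'r) \<Rightarrow> nat \<Rightarrow> nat \<Rightarrow> 's" where
  "state_after A I \<omega> 0 = (\<lambda>v. init A (local_input_of I v) (\<omega> v))"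
| "state_after A I \<omega> (Suc t) =
     (\<lambda>v. step A (state_after A I \<omega> t v)
            (\<lambda>u. if {u, v} \<in> edges I then send A (state_after A I \<omega> t u) v else None))"

text \<open>
  On instance \<open>I\<close> with random tapes \<open>\<omega>\<close>, all vertices have decided after at most \<open>t\<close> rounds, each
  knows which of its incident edges belong to the augmentation, and the augmentation costs at
  most \<open>a\<close> times the optimum.
\<close>

definition solves_within ::
  "(tap \<Rightarrow> nat set set \<Rightarrow> real) \<Rightarrow> real \<Rightarrow> ('s, 'm, 'r) local_algorithm \<Rightarrow> tap \<Rightarrow>
   (nat \<Rightarrow> 'r) \<Rightarrow> nat \<Rightarrow> bool" where
  "solves_within cost a A I \<omega> t \<longleftrightarrow>
     (\<exists>Aug. is_augmentation I Aug \<and>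
        (\<forall>v<vcount I. decision A (state_after A I \<omega> t v) = Some {u. {v, u} \<in> Aug}) \<and>
        cost I Aug \<le> a * optimum cost I)"

text \<open>
  \<open>A\<close>, with random tapes distributed according to \<open>M\<close>, is an \<open>\<alpha>\<close>-approximation algorithm for the
  instances satisfying \<open>P\<close>, and \<open>R I\<close> bounds its number of rounds on \<open>I\<close>. Deterministic algorithms
  ignore the tapes, so they succeed with probability 1 and the bound is the one on their actual
  number of rounds. For randomized algorithms the demand is minimal: success with probability
  greater than 1/2, which also covers guarantees that hold with high probability. \<open>M\<close> is arbitrary,
  so the tapes may be independent (private coins) or correlated (shared coins). The inner
  set \<open>S\<close> makes it unnecessary to require that the success event be measurable.
\<close>

definition approximates_within ::
  "(tap \<Rightarrow> bool) \<Rightarrow> (tap \<Rightarrow> nat set set \<Rightarrow> real) \<Rightarrow> (nat \<Rightarrow> real) \<Rightarrow>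
   ('s, 'm, 'r) local_algorithm \<Rightarrow> (nat \<Rightarrow> 'r) measure \<Rightarrow> (tap \<Rightarrow> nat) \<Rightarrow> bool" where
  "approximates_within P cost \<alpha> A M R \<longleftrightarrow>
     irrevocable A \<and> prob_space M \<and>
     (\<forall>I. P I \<longrightarrow>
        (\<exists>S\<in>sets M. measure M S > 1/2 \<and>
           (\<forall>\<omega>\<in>S. solves_within cost (\<alpha> (vcount I)) A I \<omega> (R I))))"

end

theory Submission
  imports Defs
begin

text \<open>
  Let the tree be the Hamiltonian path \<open>0, \<dots>, n - 1\<close> with \<open>n = 4 * D\<close>. Joining all vertices at
  distance at most 2 along the cycle \<open>0, \<dots>, n - 1, 0\<close> gives a graph of diameter \<open>D\<close> in which the
  single edge \<open>{0, n - 1}\<close> is an augmentation. Without the edges that wrap around, every tree edge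
  has to be covered by a chord of length 2. A vertex far from both ends of the path cannot
  distinguish the two graphs in few rounds, so on the squared cycle the tree edges in the middle are
  covered by chords as well. In the weighted case \<open>{0, n - 1}\<close> costs nothing and the chords do not,
  so not even one of them may be bought. In the unweighted case the number of chords is about half
  the number of tree edges in the middle, which an approximation ratio below \<open>(n - 1) / (2 * c)\<close>
  forbids unless a constant fraction of the path is within reach of its ends. The diameter of the
  second graph is irrelevant because outputs are irrevocable.
\<close>

section \<open>The two instances: squared cycle and squared path\<close>

definition band :: "nat \<Rightarrow> nat set \<Rightarrow> nat set set" where
  "band n S = {{u, v} | u v. u < v \<and> v < n \<and> v - u \<in> S}"

abbreviation "path_edges n \<equiv> band n {1}"
abbreviation "ladder_edges n \<equiv> band n {1, 2}"
text \<open>Label differences \<open>n - 2\<close> and \<open>n - 1\<close> are the edges of length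
  2 and 1 along the cycle that wrap around.\<close>

abbreviation "ring_edges n \<equiv> band n {1, 2, n - 2, n - 1}"

definition ring :: "nat \<Rightarrow> (nat set \<Rightarrow> real) \<Rightarrow> tap" where
  "ring n w = \<lparr>vcount = n, edges = ring_edges n, weight = w, tree = path_edges n, root = 0\<rparr>"

definition ladder :: "nat \<Rightarrow> (nat set \<Rightarrow> real) \<Rightarrow> tap" where
  "ladder n w = \<lparr>vcount = n, edges = ladder_edges n, weight = w, tree = path_edges n, root = 0\<rparr>"

lemma ring_simps [simp]:
  "vcount (ring n w) = n" "edges (ring n w) = ring_edges n" "weight (ring n w) = w"
  "tree (ring n w) = path_edges n" "root (ring n w) = 0"
  by (simp_all add: ring_def)

lemma ladder_simps [simp]:
  "vcount (ladder n w) = n" "edges (ladder n w) = ladder_edges n" "weight (ladder n w) = w"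
  "tree (ladder n w) = path_edges n" "root (ladder n w) = 0"
  by (simp_all add: ladder_def)

lemma doubleton_in_band_iff:
  "{u, v} \<in> band n S \<longleftrightarrow> u < v \<and> v < n \<and> v - u \<in> S \<or> v < u \<and> u < n \<and> u - v \<in> S"
  unfolding band_def by (auto simp: doubleton_eq_iff)

lemma band_mono: "S \<subseteq> S' \<Longrightarrow> band n S \<subseteq> band n S'"
  unfolding band_def by auto

lemma finite_band [simp]: "finite (band n S)"
  by (rule finite_subset[of _ "Pow {..<n}"]) (auto simp: band_def)

lemma simple_graph_band: "simple_graph n (band n S)"
  unfolding simple_graph_def band_def
  by clarify (metis less_trans nat_neq_iff)


section \<open>Connectivity\<close>

lemma sym_adj: "sym (adj E)"
  unfolding adj_def sym_def by (auto simp: insert_commute)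

lemma adj_mono: "E \<subseteq> F \<Longrightarrow> adj E \<subseteq> adj F"
  unfolding adj_def by auto

lemma connected_graph_mono:
  "connected_graph n E \<Longrightarrow> E \<subseteq> F \<Longrightarrow> connected_graph n F"
  unfolding connected_graph_def using rtrancl_mono[OF adj_mono] by blast

lemma two_edge_connected_mono:
  assumes "two_edge_connected n E" "E \<subseteq> F"
  shows "two_edge_connected n F"
proof -
  have "connected_graph n (F - {e})" for e
  proof -
    have "connected_graph n (E - {e})"
      using assms(1) unfolding two_edge_connected_def by (cases "e \<in> E") auto
    then show ?thesis
      by (rule connected_graph_mono) (use assms(2) in auto)
  qed
  then show ?thesis
    using assms connected_graph_mono unfolding two_edge_connected_def by blast
qed

lemma rtrancl_interval:
  assumes "\<And>i. a \<le> i \<Longrightarrow> i < b \<Longrightarrow> (i, Suc i) \<in> R\<^sup>*" and "a \<le> b"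
  shows "(a, b) \<in> R\<^sup>*"
  using assms(2,1)
proof (induction b rule: dec_induct)
  case base
  then show ?case by simp
next
  case (step b)
  have "(a, b) \<in> R\<^sup>*" "(b, Suc b) \<in> R\<^sup>*"
    using step by auto
  then show ?case by (rule rtrancl_trans)
qed

lemma rtrancl_adj_sym: "(u, v) \<in> (adj E)\<^sup>* \<Longrightarrow> (v, u) \<in> (adj E)\<^sup>*"
  using sym_rtrancl[OF sym_adj] by (rule symD)

lemma connected_graphI_Suc:
  assumes "\<And>i. Suc i < n \<Longrightarrow> (i, Suc i) \<in> (adj E)\<^sup>*"
  shows "connected_graph n E"
proof -
  have "(u, v) \<in> (adj E)\<^sup>*" if "u \<le> v" "v < n" for u v
    by (rule rtrancl_interval) (use that assms in auto)
  then show ?thesis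
    unfolding connected_graph_def using rtrancl_adj_sym by (metis nat_le_linear)
qed

text \<open>A walk that starts inside \<open>X\<close> and ends outside must leave \<open>X\<close>
  somewhere. Applied to an initial segment of the path, this finds the edge that bridges a deleted
  tree edge.\<close>

lemma connected_graph_crosses_cut:
  assumes "connected_graph n E" and "u < n" "v < n" and "u \<in> X" "v \<notin> X"
  obtains x y where "{x, y} \<in> E" "x \<in> X" "y \<notin> X"
proof -
  have "(u, v) \<in> (adj E)\<^sup>*"
    using assms unfolding connected_graph_def by blast
  then have "v \<notin> X \<longrightarrow> (\<exists>x y. {x, y} \<in> E \<and> x \<in> X \<and> y \<notin> X)"
    by (induction rule: rtrancl_induct) (use assms(4) in \<open>auto simp: adj_def\<close>)
  then show ?thesis
    using assms(5) that by blast
qed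

lemma connected_path: "connected_graph n (path_edges n)"
  by (rule connected_graphI_Suc) (auto simp: adj_def doubleton_in_band_iff)

text \<open>Every path edge lies in a triangle with a third nearby vertex and can be bypassed;
  deleting a chord leaves the path intact.\<close>

lemma two_edge_connected_ladder:
  assumes "3 \<le> n"
  shows "two_edge_connected n (ladder_edges n)"
proof -
  have "connected_graph n (ladder_edges n - {e})" for e
  proof (rule connected_graphI_Suc)
    fix i assume i: "Suc i < n"
    let ?A = "adj (ladder_edges n - {e})"
    show "(i, Suc i) \<in> ?A\<^sup>*"
    proof (cases "e = {i, Suc i}")
      case False
      then show ?thesis
        using i by (intro r_into_rtrancl) (auto simp: adj_def doubleton_in_band_iff)
    next
      case e: True
      show ?thesis
      proof (cases "Suc (Suc i) < n")
        case True
        then have "(i, Suc (Suc i)) \<in> ?A" "(Suc (Suc i), Suc i) \<in> ?A"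
          using e by (auto simp: adj_def doubleton_in_band_iff doubleton_eq_iff)
        then show ?thesis by (meson rtrancl.simps)
      next
        \<comment> \<open>At the end of the path the third vertex of the triangle is
          \<open>i - 1\<close>, which exists because \<open>3 \<le> n\<close>.\<close>
        case False
        then have "(i, i - 1) \<in> ?A" "(i - 1, Suc i) \<in> ?A"
          using e i assms by (auto simp: adj_def doubleton_in_band_iff doubleton_eq_iff)
        then show ?thesis by (meson rtrancl.simps)
      qed
    qed
  qed
  moreover have "connected_graph n (ladder_edges n)"
    by (rule connected_graph_mono[OF connected_path band_mono]) auto
  ultimately show ?thesis
    unfolding two_edge_connected_def by blast
qed

lemma two_edge_connected_ring:
  "3 \<le> n \<Longrightarrow> two_edge_connected n (ring_edges n)"
  by (erule two_edge_connected_mono[OF two_edge_connected_ladder]) (auto intro!: band_mono)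

text \<open>The graph is a Hamiltonian cycle. Around a deleted \<open>{i, i + 1}\<close> the detour
  runs from \<open>i\<close> down to \<open>0\<close>, over the closing edge to
  \<open>n - 1\<close>, and down to \<open>i + 1\<close>.\<close>

lemma two_edge_connected_closed_path:
  assumes "3 \<le> n"
  shows "two_edge_connected n (path_edges n \<union> {{0, n - 1}})"
proof -
  let ?C = "path_edges n \<union> {{0, n - 1}}"
  have "connected_graph n (?C - {e})" for e
  proof (cases "e = {0, n - 1}")
    case True
    then show ?thesis
      using assms
      by (intro connected_graph_mono[OF connected_path]) (auto simp: doubleton_in_band_iff)
  next
    case False
    let ?A = "adj (?C - {e})"
    have close: "(0, n - 1) \<in> ?A\<^sup>*"
      using False by (intro r_into_rtrancl) (auto simp: adj_def)
    show ?thesis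
    proof (rule connected_graphI_Suc)
      fix i assume i: "Suc i < n"
      have direct: "(j, Suc j) \<in> ?A\<^sup>*" if "Suc j < n" "e \<noteq> {j, Suc j}" for j
        using that by (intro r_into_rtrancl) (auto simp: adj_def doubleton_in_band_iff)
      show "(i, Suc i) \<in> ?A\<^sup>*"
      proof (cases "e = {i, Suc i}")
        case True
        have "(0, i) \<in> ?A\<^sup>*"
          by (rule rtrancl_interval, rule direct) (use i True in \<open>auto simp: doubleton_eq_iff\<close>)
        moreover have "(Suc i, n - 1) \<in> ?A\<^sup>*"
          by (rule rtrancl_interval, rule direct) (use i True in \<open>auto simp: doubleton_eq_iff\<close>)
        ultimately show ?thesis
          using close by (meson rtrancl_adj_sym rtrancl_trans)
      qed (use direct i in blast)
    qed
  qed
  moreover have "connected_graph n ?C"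
    by (rule connected_graph_mono[OF connected_path]) auto
  ultimately show ?thesis
    unfolding two_edge_connected_def by blast
qed

text \<open>Both neighbours of the largest vertex of a cycle would have to be its predecessor.\<close>

lemma path_acyclic: "\<not> is_cycle (path_edges n) p"
proof
  assume "is_cycle (path_edges n) p"
  then have len: "3 \<le> length p" and dist: "distinct p"
    and edge: "\<And>i. i < length p \<Longrightarrow> {p ! i, p ! ((i + 1) mod length p)} \<in> path_edges n"
    unfolding is_cycle_def by auto
  have "Max (set p) \<in> set p"
    using len by (intro Max_in) auto
  then obtain i where i: "i < length p" "p ! i = Max (set p)"
    by (metis in_set_conv_nth)
  have le: "p ! j \<le> p ! i" if "j < length p" for j
    using that i by simp
  \<comment> \<open>The positions after and before \<open>i\<close> on the cycle; they differ
    because the cycle has at least 3 vertices.\<close>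
  let ?s = "if i + 1 = length p then 0 else i + 1"
  let ?r = "if i = 0 then length p - 1 else i - 1"
  have "(i + 1) mod length p = ?s" "(?r + 1) mod length p = i"
    using i len by auto
  then have "{p ! i, p ! ?s} \<in> path_edges n" "{p ! ?r, p ! i} \<in> path_edges n"
    using edge[of i] edge[of ?r] i len by (auto split: if_splits)
  moreover have s: "?s < length p" and r: "?r < length p" and "?s \<noteq> ?r"
    using i len by auto
  ultimately have "p ! ?s = p ! ?r"
    using le[OF s] le[OF r] by (auto simp: doubleton_in_band_iff simp del: nth_eq_iff_index_eq)
  then show False
    using dist s r \<open>?s \<noteq> ?r\<close> by (simp only: nth_eq_iff_index_eq)
qed

lemma spanning_tree_path: "1 \<in> S \<Longrightarrow> spanning_tree n (band n S) (path_edges n)"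
  unfolding spanning_tree_def using path_acyclic connected_path band_mono[of "{1}" S n] by auto


section \<open>The diameter of the squared cycle\<close>

lemma sym_relpow: "sym R \<Longrightarrow> sym (R ^^ k)"
proof (induction k)
  case (Suc k)
  show ?case
  proof (rule symI)
    fix x y assume "(x, y) \<in> R ^^ Suc k"
    then obtain z where "(x, z) \<in> R ^^ k" "(z, y) \<in> R" by auto
    then have "(y, z) \<in> R" "(z, x) \<in> R ^^ k"
      using Suc by (auto dest: symD)
    then show "(y, x) \<in> R ^^ Suc k" by (rule relpow_Suc_I2)
  qed
qed (simp add: sym_Id)

text \<open>Steps of length 2 along the cycle, and a single step of length 1 if \<open>j\<close> is
  odd; hence the rounding up.\<close>

lemma ring_walk:
  assumes n: "3 \<le> n" and "u < n"
  shows "(u, (u + j) mod n) \<in> adj (ring_edges n) ^^ ((j + 1) div 2)"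
proof -
  have one: "(x, (x + 1) mod n) \<in> adj (ring_edges n)" if "x < n" for x
    using that n by (cases "x + 1 = n") (auto simp: adj_def doubleton_in_band_iff)
  have two: "(x, (x + 2) mod n) \<in> adj (ring_edges n)" if "x < n" for x
  proof -
    have "x + 2 < n \<or> x + 2 = n \<or> x = n - 1"
      using that by linarith
    then show ?thesis
    proof (elim disjE)
      assume x: "x = n - 1"
      then have "(x + 2) mod n = 1"
        using n by (simp add: mod_if)
      then show ?thesis
        using n x by (auto simp: adj_def doubleton_in_band_iff)
    qed (use n in \<open>auto simp: adj_def doubleton_in_band_iff\<close>)
  qed
  show ?thesis
  proof (induction j rule: induct_nat_012)
    case 0
    then show ?case using assms by simp
  next
    case 1
    then show ?case using one[OF \<open>u < n\<close>] by simp
  next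
    case (ge2 j)
    have "((u + j) mod n, ((u + j) mod n + 2) mod n) \<in> adj (ring_edges n)"
      using n by (intro two) simp
    then have "((u + j) mod n, (u + Suc (Suc j)) mod n) \<in> adj (ring_edges n)"
      by (simp add: mod_simps)
    moreover have "(Suc (Suc j) + 1) div 2 = Suc ((j + 1) div 2)" by simp
    ultimately show ?case
      using ge2(1) by (auto intro: relcompI)
  qed
qed

lemma gdist_le: "(u, v) \<in> adj E ^^ k \<Longrightarrow> gdist E u v \<le> k"
  unfolding gdist_def by (rule Least_le)

text \<open>The shorter arc of the cycle has length at most \<open>2 * D\<close>. Asserting a walk
  instead of a bound on \<open>gdist\<close> also provides the reachability without which
  \<open>gdist\<close> is meaningless.\<close>

lemma ring_gdist_le:
  assumes D: "0 < D" and "u < 4 * D" "v < 4 * D"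
  shows "\<exists>k\<le>D. (u, v) \<in> adj (ring_edges (4 * D)) ^^ k"
proof -
  let ?R = "adj (ring_edges (4 * D))"
  have n: "3 \<le> 4 * D" using D by linarith
  have *: "\<exists>k\<le>D. (u, v) \<in> ?R ^^ k" if "u \<le> v" "v < 4 * D" for u v
  proof (cases "v - u \<le> 2 * D")
    case True
    have "(u, (u + (v - u)) mod (4 * D)) \<in> ?R ^^ ((v - u + 1) div 2)"
      using that n by (intro ring_walk) auto
    moreover have "(v - u + 1) div 2 \<le> D"
      using True by linarith
    ultimately show ?thesis
      using that by auto
  next
    case False
    let ?j = "4 * D - (v - u)"
    have "(v, (v + ?j) mod (4 * D)) \<in> ?R ^^ ((?j + 1) div 2)"
      using that n by (intro ring_walk) auto
    moreover have "v + ?j = u + 4 * D" using that by linarith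
    ultimately have "(v, u) \<in> ?R ^^ ((?j + 1) div 2)"
      using that by simp
    then have "(u, v) \<in> ?R ^^ ((?j + 1) div 2)"
      by (rule symD[OF sym_relpow[OF sym_adj]])
    moreover have "(?j + 1) div 2 \<le> D"
      using False by linarith
    ultimately show ?thesis by blast
  qed
  show ?thesis
  proof (cases "u \<le> v")
    case False
    then obtain k where "k \<le> D" "(v, u) \<in> ?R ^^ k"
      using *[of v u] assms by auto
    then show ?thesis
      using symD[OF sym_relpow[OF sym_adj]] by blast
  qed (use * assms in blast)
qed

text \<open>The distance to \<open>0\<close> along the cycle of length \<open>n\<close> changes by at most 2 per edge.\<close>

lemma ring_walk_potential:
  assumes "(u, v) \<in> adj (ring_edges n) ^^ k"
  shows "min v (n - v) \<le> min u (n - u) + 2 * k"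
  using assms
proof (induction k arbitrary: v)
  case (Suc k)
  then obtain x where x: "(u, x) \<in> adj (ring_edges n) ^^ k" "(x, v) \<in> adj (ring_edges n)"
    by auto
  have "min v (n - v) \<le> min x (n - x) + 2"
    using x(2) by (auto simp: adj_def doubleton_in_band_iff)
  also have "\<dots> \<le> min u (n - u) + 2 * k + 2"
    by (rule add_right_mono[OF Suc.IH[OF x(1)]])
  finally show ?case by simp
qed simp

lemma diameter_of_ring:
  assumes "0 < D"
  shows "diameter_of (ring (4 * D) w) = D"
proof -
  let ?E = "ring_edges (4 * D)" and ?G = "{gdist (ring_edges (4 * D)) u v | u v. u < 4 * D \<and> v < 4 * D}"
  have le: "gdist ?E u v \<le> D" if "u < 4 * D" "v < 4 * D" for u v
    using ring_gdist_le[OF assms that] gdist_le le_trans by blast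
  have "\<exists>k. (0, 2 * D) \<in> adj ?E ^^ k"
    using ring_gdist_le[OF assms, of 0 "2 * D"] assms by auto
  then have "(0, 2 * D) \<in> adj ?E ^^ gdist ?E 0 (2 * D)"
    unfolding gdist_def by (rule LeastI_ex)
  \<comment> \<open>The potential is 0 at vertex \<open>0\<close> and \<open>2 * D\<close> at the
    antipodal vertex.\<close>
  from ring_walk_potential[OF this] have "D \<le> gdist ?E 0 (2 * D)"
    by simp
  then have "gdist ?E 0 (2 * D) = D"
    using le[of 0 "2 * D"] assms by simp
  then have "D \<in> ?G"
    using assms by (intro CollectI exI[of _ 0] exI[of _ "2 * D"]) auto
  moreover have "finite ?G"
    by (rule finite_subset[of _ "{..D}"]) (use le in auto)
  ultimately have "Max ?G = D"
    using le by (intro Max_eqI) auto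
  then show ?thesis
    by (simp add: diameter_of_def graph_diameter_def)
qed


section \<open>Indistinguishability and the lower bound\<close>

lemma weighted_tap_ring:
  "3 \<le> n \<Longrightarrow> (\<And>e. 0 \<le> w e) \<Longrightarrow> weighted_tap (ring n w)"
  by (simp add: weighted_tap_def simple_graph_band two_edge_connected_ring[simplified]
      spanning_tree_path[simplified])

lemma weighted_tap_ladder:
  "3 \<le> n \<Longrightarrow> (\<And>e. 0 \<le> w e) \<Longrightarrow> weighted_tap (ladder n w)"
  by (simp add: weighted_tap_def simple_graph_band two_edge_connected_ladder[simplified]
      spanning_tree_path[simplified])

text \<open>A \<open>Min\<close> is a lower bound only over a finite set: finitely many edges allow
  finitely many augmentations.\<close>

lemma optimum_le:
  assumes "finite (edges I)" "is_augmentation I Aug"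
  shows "optimum cost I \<le> cost I Aug"
proof -
  have "finite {Aug. is_augmentation I Aug}"
    by (rule finite_subset[of _ "Pow (edges I)"]) (use assms in \<open>auto simp: is_augmentation_def\<close>)
  then show ?thesis
    unfolding optimum_def using assms by (intro Min_le) auto
qed

lemma ring_optimum_le:
  assumes "3 \<le> n"
  shows "optimum cost (ring n w) \<le> cost (ring n w) {{0, n - 1}}"
  using assms
  by (intro optimum_le) (auto simp: is_augmentation_def doubleton_in_band_iff
      intro: two_edge_connected_closed_path[simplified])

text \<open>The edges that wrap around meet only the vertices \<open>0\<close>, \<open>1\<close>,
  \<open>n - 2\<close> and \<open>n - 1\<close>.\<close>

lemma middle_edge_iff:
  assumes "2 \<le> v" "v + 2 < n"
  shows "{u, v} \<in> ring_edges n \<longleftrightarrow> {u, v} \<in> ladder_edges n"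
  using assms by (auto simp: doubleton_in_band_iff)

text \<open>Away from the ends the local inputs agree. Information crosses one edge per round, hence
  at most 2 labels, so the zone of agreement shrinks by 2 at either end.\<close>

lemma state_after_ring_eq_ladder:
  assumes "2 + 2 * t \<le> v" "v + 2 + 2 * t < n"
  shows "state_after A (ring n w) \<omega> t v = state_after A (ladder n w) \<omega> t v"
  using assms
proof (induction t arbitrary: v)
  case 0
  have "{v, u} \<in> ring_edges n \<longleftrightarrow> {v, u} \<in> ladder_edges n" for u
    using middle_edge_iff[of v n u] 0 by (simp add: insert_commute)
  \<comment> \<open>Parents depend only on the tree and the root, which the two instances
    share.\<close>
  moreover have "parent (ring n w) v = parent (ladder n w) v"
    by (simp add: parent_def)
  ultimately show ?case
    by (simp add: local_input_of_def cong: if_cong)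
next
  case (Suc t)
  have "(if {u, v} \<in> ring_edges n then send A (state_after A (ring n w) \<omega> t u) v else None) =
        (if {u, v} \<in> ladder_edges n then send A (state_after A (ladder n w) \<omega> t u) v else None)"
    for u
  proof (cases "{u, v} \<in> ladder_edges n")
    case True
    then have "state_after A (ring n w) \<omega> t u = state_after A (ladder n w) \<omega> t u"
      using Suc.prems by (intro Suc.IH) (auto simp: doubleton_in_band_iff)
    then show ?thesis
      using middle_edge_iff[of v n u] Suc.prems by simp
  qed (use middle_edge_iff[of v n u] Suc.prems in simp)
  then show ?case
    using Suc by simp
qed

section \<open>Transfer of outputs from the path to the cycle\<close>

lemma decision_stable:
  assumes "irrevocable A" "decision A (state_after A I \<omega> t v) = Some X" "t \<le> t'"
  shows "decision A (state_after A I \<omega> t' v) = Some X"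
  using assms(3,2) by (induction t' rule: dec_induct) (use assms(1) in \<open>auto simp: irrevocable_def\<close>)

text \<open>Both outputs persist until the later of the two times. This allows comparing runs with
  different round bounds.\<close>

lemma decision_unique:
  assumes "irrevocable A"
    and "decision A (state_after A I \<omega> t v) = Some X"
    and "decision A (state_after A I \<omega> t' v) = Some Y"
  shows "X = Y"
  using decision_stable[OF assms(1,2), of "max t t'"] decision_stable[OF assms(1,3), of "max t t'"]
  by simp

text \<open>Once \<open>{v, v + 1}\<close> is deleted, something else must cross between
  \<open>{..v}\<close> and the rest, and only these two chords of the squared path do.\<close>

lemma ladder_augmentation_covers:
  assumes aug: "is_augmentation (ladder n w) Aug" and v: "1 \<le> v" "Suc v < n"
  shows "{v, v + 2} \<in> Aug \<or> {v - 1, v + 1} \<in> Aug"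
proof -
  let ?F = "path_edges n \<union> Aug - {{v, Suc v}}"
  have "{v, Suc v} \<in> path_edges n"
    using v by (simp add: doubleton_in_band_iff)
  then have "connected_graph n ?F" and sub: "Aug \<subseteq> ladder_edges n"
    using aug by (auto simp: is_augmentation_def two_edge_connected_def)
  then obtain x y where xy: "{x, y} \<in> ?F" "x \<le> v" "\<not> y \<le> v"
    using connected_graph_crosses_cut[of n ?F v "Suc v" "{..v}"] v by auto
  have "{x, y} \<in> Aug"
  proof (rule ccontr)
    assume "{x, y} \<notin> Aug"
    then have "{x, y} \<in> path_edges n" using xy by auto
    then have "x = v" "y = Suc v"
      using xy(2,3) by (auto simp: doubleton_in_band_iff)
    then show False using xy by simp
  qed
  moreover have "y - x \<in> {1, 2}"
    using subsetD[OF sub calculation] xy(2,3) by (auto simp: doubleton_in_band_iff)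
  \<comment> \<open>The first alternative is the deleted edge, which \<open>xy(1)\<close> rules
    out.\<close>
  then have "x = v \<and> y = Suc v \<or> x = v \<and> y = v + 2 \<or> x = v - 1 \<and> y = v + 1"
    using xy(2,3) by auto
  ultimately show ?thesis
    using xy(1) by auto
qed

text \<open>
  While the middle part of the path cannot tell the two instances apart, it must already guard
  against the absence of the closing edges.
\<close>

lemma ring_decision_covers:
  assumes irr: "irrevocable A"
    and dec: "\<And>v. v < n \<Longrightarrow> decision A (state_after A (ring n w) \<omega> t v) = Some {u. {v, u} \<in> Aug}"
    and lad: "solves_within cost a A (ladder n w) \<omega> t'"
    and v: "2 + 2 * t \<le> v" "v + 3 + 2 * t < n"
  shows "{v, v + 2} \<in> Aug \<or> {v - 1, v + 1} \<in> Aug"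
proof -
  obtain Aug' where aug': "is_augmentation (ladder n w) Aug'"
    and dec': "\<And>v. v < n \<Longrightarrow>
      decision A (state_after A (ladder n w) \<omega> t' v) = Some {u. {v, u} \<in> Aug'}"
    using lad unfolding solves_within_def by auto
  \<comment> \<open>The output on the cycle at time \<open>t\<close> is read off a state that also
    occurs on the path, so it equals the output there.\<close>
  have agree: "{x, u} \<in> Aug \<longleftrightarrow> {x, u} \<in> Aug'" if "2 + 2 * t \<le> x" "x + 2 + 2 * t < n" for x u
  proof -
    have "{u. {x, u} \<in> Aug} = {u. {x, u} \<in> Aug'}"
    proof (rule decision_unique[OF irr _ dec'])
      show "decision A (state_after A (ladder n w) \<omega> t x) = Some {u. {x, u} \<in> Aug}"
        using dec[of x] state_after_ring_eq_ladder[OF that, of A w \<omega>] that by simp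
    qed (use that in simp)
    then show ?thesis by blast
  qed
  \<comment> \<open>The second chord is inspected from \<open>v + 1\<close>, since
    \<open>v - 1\<close> may lie outside the zone of agreement; hence the \<open>3\<close> in the
    upper bound on \<open>v\<close>.\<close>
  have "{v, v + 2} \<in> Aug' \<or> {v + 1, v - 1} \<in> Aug'"
    using ladder_augmentation_covers[OF aug', of v] v by (auto simp: insert_commute)
  then show ?thesis
    using agree[of v "v + 2"] agree[of "v + 1" "v - 1"] v by (auto simp: insert_commute)
qed

text \<open>Disjoint sets would have total probability above 1. Thus some tapes make the algorithm
  succeed on both instances at once.\<close>

lemma majority_sets_intersect:
  assumes "prob_space M" "S \<in> sets M" "S' \<in> sets M" "measure M S > 1/2" "measure M S' > 1/2"
  obtains \<omega> where "\<omega> \<in> S" "\<omega> \<in> S'"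
proof -
  interpret prob_space M by fact
  have "S \<inter> S' \<noteq> {}"
  proof
    assume "S \<inter> S' = {}"
    then have "prob (S \<union> S') = prob S + prob S'"
      using assms by (intro finite_measure_Union) auto
    then show False
      using prob_le_1[of "S \<union> S'"] assms by linarith
  qed
  then show ?thesis using that by blast
qed

text \<open>Fixes tapes that succeed on both instances and keeps only facts about the cycle, so that
  the round bound on the path disappears.\<close>

lemma ring_run:
  assumes apx: "approximates_within P cost \<alpha> A M R"
    and P: "P (ring n w)" "P (ladder n w)" and n: "3 \<le> n" and \<alpha>: "1 \<le> \<alpha> n"
  obtains Aug where "is_augmentation (ring n w) Aug"
    and "cost (ring n w) Aug \<le> \<alpha> n * cost (ring n w) {{0, n - 1}}"
    and "\<And>v. 2 + 2 * R (ring n w) \<le> v \<Longrightarrow> v + 3 + 2 * R (ring n w) < n \<Longrightarrow>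
           {v, v + 2} \<in> Aug \<or> {v - 1, v + 1} \<in> Aug"
proof -
  have irr: "irrevocable A" and M: "prob_space M"
    and sol: "\<And>I. P I \<Longrightarrow> \<exists>S\<in>sets M. measure M S > 1/2 \<and>
               (\<forall>\<omega>\<in>S. solves_within cost (\<alpha> (vcount I)) A I \<omega> (R I))"
    using apx unfolding approximates_within_def by auto
  obtain S where S: "S \<in> sets M" "measure M S > 1/2"
    "\<forall>\<omega>\<in>S. solves_within cost (\<alpha> n) A (ring n w) \<omega> (R (ring n w))"
    using sol[OF P(1)] by auto
  obtain S' where S': "S' \<in> sets M" "measure M S' > 1/2"
    "\<forall>\<omega>\<in>S'. solves_within cost (\<alpha> n) A (ladder n w) \<omega> (R (ladder n w))"
    using sol[OF P(2)] by auto
  obtain \<omega> where "\<omega> \<in> S" "\<omega> \<in> S'"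
    by (rule majority_sets_intersect[OF M S(1) S'(1) S(2) S'(2)])
  then have "solves_within cost (\<alpha> n) A (ring n w) \<omega> (R (ring n w))"
    and lad: "solves_within cost (\<alpha> n) A (ladder n w) \<omega> (R (ladder n w))"
    using S(3) S'(3) by auto
  then obtain Aug where aug: "is_augmentation (ring n w) Aug"
    and dec: "\<And>v. v < n \<Longrightarrow>
      decision A (state_after A (ring n w) \<omega> (R (ring n w)) v) = Some {u. {v, u} \<in> Aug}"
    and "cost (ring n w) Aug \<le> \<alpha> n * optimum cost (ring n w)"
    unfolding solves_within_def by auto
  moreover have "\<alpha> n * optimum cost (ring n w) \<le> \<alpha> n * cost (ring n w) {{0, n - 1}}"
    using ring_optimum_le[OF n] \<alpha> by (intro mult_left_mono) auto
  ultimately show ?thesis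
    using aug ring_decision_covers[OF irr dec lad] by (intro that) auto
qed

text \<open>A chord \<open>{i, i + 2}\<close> covers only the tree edges \<open>{i, i + 1}\<close> and \<open>{i + 1, i + 2}\<close>.\<close>

lemma card_covering_chords:
  assumes "finite F" and cov: "\<And>v. a \<le> v \<Longrightarrow> v < b \<Longrightarrow> {v, v + 2} \<in> F \<or> {v - 1, v + 1} \<in> F"
    and "1 \<le> a"
  shows "b - a \<le> 2 * card F"
proof -
  \<comment> \<open>The number \<open>v\<close> stands for the tree edge \<open>{v, v + 1}\<close>,
    and \<open>Min e\<close> recovers the left end of a chord. As \<open>1 \<le> a\<close>, the
    subtraction in \<open>v - 1\<close> is exact.\<close>
  have "{a..<b} \<subseteq> (\<Union>e\<in>F. {Min e, Suc (Min e)})"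
  proof
    fix v assume "v \<in> {a..<b}"
    then consider "{v, v + 2} \<in> F" | "{v - 1, v + 1} \<in> F" "1 \<le> v"
      using cov \<open>1 \<le> a\<close> by force
    then show "v \<in> (\<Union>e\<in>F. {Min e, Suc (Min e)})"
    proof cases
      case 1
      then show ?thesis by (intro UN_I[of "{v, v + 2}"]) auto
    next
      case 2
      then show ?thesis by (intro UN_I[of "{v - 1, v + 1}"]) auto
    qed
  qed
  then have "card {a..<b} \<le> card (\<Union>e\<in>F. {Min e, Suc (Min e)})"
    using \<open>finite F\<close> by (intro card_mono) auto
  also have "\<dots> \<le> (\<Sum>e\<in>F. card {Min e, Suc (Min e)})"
    using \<open>finite F\<close> by (rule card_UN_le)
  also have "\<dots> = 2 * card F"
    by simp
  finally show ?thesis by simp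
qed

section \<open>The lower bounds for weighted and unweighted TAP\<close>

lemma weighted_lower_bound:
  assumes apx: "approximates_within weighted_tap total_weight \<alpha> A M R"
    and \<alpha>: "\<And>n. 1 \<le> n \<Longrightarrow> 1 \<le> \<alpha> n" and D: "2 \<le> D"
  shows "\<exists>I. weighted_tap I \<and> diameter_of I = D \<and> 1/2 * real D \<le> real (R I)"
proof -
  define n where "n = 4 * D"
  \<comment> \<open>The free closing edge makes the optimum 0, and with it every multiple of the
    optimum.\<close>
  define w :: "nat set \<Rightarrow> real" where "w = (\<lambda>e. if e = {0, n - 1} then 0 else 1)"
  define t where "t = R (ring n w)"
  have n: "3 \<le> n" using D by (simp add: n_def)
  have tap: "weighted_tap (ring n w)" "weighted_tap (ladder n w)"
    using n by (auto intro!: weighted_tap_ring weighted_tap_ladder simp: w_def)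
  obtain Aug where aug: "is_augmentation (ring n w) Aug"
    and cost: "total_weight (ring n w) Aug \<le> \<alpha> n * total_weight (ring n w) {{0, n - 1}}"
    and cov: "\<And>v. 2 + 2 * t \<le> v \<Longrightarrow> v + 3 + 2 * t < n \<Longrightarrow> {v, v + 2} \<in> Aug \<or> {v - 1, v + 1} \<in> Aug"
    unfolding t_def using ring_run[OF apx tap n \<alpha>] n by (metis add_leE numeral_3_eq_3 plus_1_eq_Suc)
  have "finite Aug"
    using aug by (auto simp: is_augmentation_def intro: finite_subset)
  have free: "Aug \<subseteq> {{0, n - 1}}"
  proof
    fix e assume "e \<in> Aug"
    then have "w e \<le> (\<Sum>e\<in>Aug. w e)"
      using \<open>finite Aug\<close> by (intro member_le_sum) (auto simp: w_def)
    also have "\<dots> \<le> 0"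
      using cost by (simp add: total_weight_def w_def)
    finally show "e \<in> {{0, n - 1}}"
      by (auto simp: w_def split: if_splits)
  qed
  \<comment> \<open>Otherwise \<open>2 + 2 * t\<close> would be an index at which \<open>cov\<close>
    forces a chord of positive weight.\<close>
  have "\<not> 2 + 2 * t + 3 + 2 * t < n"
  proof
    assume "2 + 2 * t + 3 + 2 * t < n"
    then show False
      using cov[of "2 + 2 * t"] free by (auto simp: doubleton_eq_iff)
  qed
  \<comment> \<open>From \<open>4 * D \<le> 4 * t + 5\<close> follows \<open>D \<le> t + 1\<close>;
    as \<open>2 \<le> D\<close>, this gives \<open>1 \<le> t\<close>, which absorbs the
    constant.\<close>
  then have "D \<le> 2 * t"
    using D unfolding n_def by presburger
  then have "1/2 * real D \<le> real t"
    by simp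
  then show ?thesis
    using tap diameter_of_ring[of D w] D unfolding t_def n_def by (intro exI[of _ "ring (4 * D) w"]) auto
qed

text \<open>The optimum is at most 1, so fewer than \<open>(n - 1) / (2 * c)\<close> edges may be
  bought, and each chord covers two tree edges. Up to a constant, a fraction
  \<open>1 - 1 / c\<close> of the tree edges must then lie within reach of the ends.\<close>

lemma unweighted_lower_bound:
  assumes apx: "approximates_within unweighted_tap edge_count \<alpha> A M R"
    and \<alpha>: "\<And>n. 1 \<le> n \<Longrightarrow> 1 \<le> \<alpha> n" and c: "1 < c"
    and upper: "\<alpha> (4 * D) < (real (4 * D) - 1) / (2 * c)"
    and D: "2 / (1 - 1 / c) + 1 \<le> real D"
  shows "\<exists>I. unweighted_tap I \<and> diameter_of I = D \<and> (1 - 1 / c) / 2 * real D \<le> real (R I)"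
proof -
  define n where "n = 4 * D"
  define w :: "nat set \<Rightarrow> real" where "w = (\<lambda>_. 1)"
  define t where "t = R (ring n w)"
  define \<delta> where "\<delta> = 1 - 1 / c"
  have \<delta>: "0 < \<delta>" "\<delta> \<le> 1" using c by (auto simp: \<delta>_def)
  then have "1 \<le> 2 / \<delta>" by simp
  then have D2: "2 \<le> D" using D by (simp add: \<delta>_def)
  then have n: "3 \<le> n" by (simp add: n_def)
  have tap: "unweighted_tap (ring n w)" "unweighted_tap (ladder n w)"
    using n by (auto intro!: weighted_tap_ring weighted_tap_ladder simp: w_def unweighted_tap_def)
  obtain Aug where aug: "is_augmentation (ring n w) Aug"
    and cost: "edge_count (ring n w) Aug \<le> \<alpha> n * edge_count (ring n w) {{0, n - 1}}"
    and cov: "\<And>v. 2 + 2 * t \<le> v \<Longrightarrow> v + 3 + 2 * t < n \<Longrightarrow> {v, v + 2} \<in> Aug \<or> {v - 1, v + 1} \<in> Aug"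
    unfolding t_def using ring_run[OF apx tap n \<alpha>] n by (metis add_leE numeral_3_eq_3 plus_1_eq_Suc)
  have "finite Aug"
    using aug by (auto simp: is_augmentation_def intro: finite_subset)
  then have "(n - (3 + 2 * t)) - (2 + 2 * t) \<le> 2 * card Aug"
    by (rule card_covering_chords) (use cov in auto)
  then have "real n - 5 - 4 * real t \<le> 2 * real (card Aug)"
    by linarith
  also have "\<dots> \<le> 2 * \<alpha> n"
    using cost by (simp add: edge_count_def)
  also have "\<dots> < (real n - 1) / c"
    using upper c by (simp add: n_def field_simps)
  \<comment> \<open>Here \<open>(n - 1) / c\<close> is
    \<open>(n - 1) * (1 - \<delta>)\<close>.\<close>
  finally have "(real n - 1) * \<delta> < 4 + 4 * real t"
    by (simp add: \<delta>_def algebra_simps diff_divide_distrib)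
  then have "\<delta> * real D - \<delta> / 4 - 1 < real t"
    by (simp add: n_def algebra_simps)
  \<comment> \<open>Half of \<open>\<delta> * D\<close> is at least \<open>1 + \<delta> / 2\<close>
    and absorbs the loss \<open>1 + \<delta> / 4\<close>.\<close>
  moreover have "2 + \<delta> \<le> \<delta> * real D"
    using mult_left_mono[OF D, of \<delta>] \<delta> by (simp add: \<delta>_def[symmetric] algebra_simps)
  ultimately have "\<delta> / 2 * real D \<le> real t"
    using \<delta> by (simp add: algebra_simps)
  then show ?thesis
    using tap diameter_of_ring[of D w] D2 unfolding t_def n_def \<delta>_def
    by (intro exI[of _ "ring (4 * D) w"]) auto
qed

theorem theorem4:
  shows
    "(\<exists>\<kappa>>0. \<forall>(\<alpha> :: nat \<Rightarrow> real) (k :: nat).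
        (\<forall>n\<ge>1. 1 \<le> \<alpha> n) \<longrightarrow>
        \<alpha> \<in> O(\<lambda>n. real n ^ k) \<longrightarrow>
        (\<exists>D0. \<forall>(A :: ('s, 'm, 'r) local_algorithm) M R.
           approximates_within weighted_tap total_weight \<alpha> A M R \<longrightarrow>
           (\<forall>D\<ge>D0. \<exists>I. weighted_tap I \<and> diameter_of I = D \<and> \<kappa> * real D \<le> real (R I))))
     \<and>
     (\<forall>c>(1 :: real). \<exists>\<kappa>>0. \<forall>\<alpha> :: nat \<Rightarrow> real.
        (\<forall>n\<ge>1. 1 \<le> \<alpha> n) \<longrightarrow>
        (\<forall>\<^sub>F n in sequentially. \<alpha> n < (real n - 1) / (2 * c)) \<longrightarrow>
        (\<exists>D0. \<forall>(A :: ('s, 'm, 'r) local_algorithm) M R.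
           approximates_within unweighted_tap edge_count \<alpha> A M R \<longrightarrow>
           (\<forall>D\<ge>D0. \<exists>I. unweighted_tap I \<and> diameter_of I = D \<and> \<kappa> * real D \<le> real (R I))))"
proof (rule conjI)
  show "\<exists>\<kappa>>0. \<forall>(\<alpha> :: nat \<Rightarrow> real) (k :: nat).
        (\<forall>n\<ge>1. 1 \<le> \<alpha> n) \<longrightarrow>
        \<alpha> \<in> O(\<lambda>n. real n ^ k) \<longrightarrow>
        (\<exists>D0. \<forall>(A :: ('s, 'm, 'r) local_algorithm) M R.
           approximates_within weighted_tap total_weight \<alpha> A M R \<longrightarrow>
           (\<forall>D\<ge>D0. \<exists>I. weighted_tap I \<and> diameter_of I = D \<and> \<kappa> * real D \<le> real (R I)))"
  proof (intro exI[of _ "1/2 :: real"] conjI allI impI exI[of _ "2 :: nat"])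
    fix \<alpha> :: "nat \<Rightarrow> real" and A :: "('s, 'm, 'r) local_algorithm" and M R and D :: nat
    assume "\<forall>n\<ge>1. 1 \<le> \<alpha> n" "approximates_within weighted_tap total_weight \<alpha> A M R" "2 \<le> D"
    then show "\<exists>I. weighted_tap I \<and> diameter_of I = D \<and> 1/2 * real D \<le> real (R I)"
      by (intro weighted_lower_bound) auto
  qed simp
next
  show "\<forall>c>(1 :: real). \<exists>\<kappa>>0. \<forall>\<alpha> :: nat \<Rightarrow> real.
        (\<forall>n\<ge>1. 1 \<le> \<alpha> n) \<longrightarrow>
        (\<forall>\<^sub>F n in sequentially. \<alpha> n < (real n - 1) / (2 * c)) \<longrightarrow>
        (\<exists>D0. \<forall>(A :: ('s, 'm, 'r) local_algorithm) M R.
           approximates_within unweighted_tap edge_count \<alpha> A M R \<longrightarrow>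
           (\<forall>D\<ge>D0. \<exists>I. unweighted_tap I \<and> diameter_of I = D \<and> \<kappa> * real D \<le> real (R I)))"
  proof (intro allI impI)
    fix c :: real
    assume c: "1 < c"
    show "\<exists>\<kappa>>0. \<forall>\<alpha> :: nat \<Rightarrow> real.
        (\<forall>n\<ge>1. 1 \<le> \<alpha> n) \<longrightarrow>
        (\<forall>\<^sub>F n in sequentially. \<alpha> n < (real n - 1) / (2 * c)) \<longrightarrow>
        (\<exists>D0. \<forall>(A :: ('s, 'm, 'r) local_algorithm) M R.
           approximates_within unweighted_tap edge_count \<alpha> A M R \<longrightarrow>
           (\<forall>D\<ge>D0. \<exists>I. unweighted_tap I \<and> diameter_of I = D \<and> \<kappa> * real D \<le> real (R I)))"
    proof (rule exI[of _ "(1 - 1 / c) / 2"], intro conjI allI impI)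
      show "0 < (1 - 1 / c) / 2" using c by simp
      fix \<alpha> :: "nat \<Rightarrow> real"
      assume \<alpha>: "\<forall>n\<ge>1. 1 \<le> \<alpha> n"
        and "\<forall>\<^sub>F n in sequentially. \<alpha> n < (real n - 1) / (2 * c)"
      then obtain N where N: "\<And>n. N \<le> n \<Longrightarrow> \<alpha> n < (real n - 1) / (2 * c)"
        unfolding eventually_sequentially by blast
      show "\<exists>D0. \<forall>(A :: ('s, 'm, 'r) local_algorithm) M R.
           approximates_within unweighted_tap edge_count \<alpha> A M R \<longrightarrow>
           (\<forall>D\<ge>D0. \<exists>I. unweighted_tap I \<and> diameter_of I = D \<and>
              (1 - 1 / c) / 2 * real D \<le> real (R I))"
      \<comment> \<open>The first bound makes the upper bound on the ratio valid at
        \<open>n = 4 * D\<close>; the second makes \<open>D\<close> large enough to absorb the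
        additive constants.\<close>
      proof (rule exI[of _ "max N (nat \<lceil>2 / (1 - 1 / c) + 1\<rceil>)"], intro allI impI)
        fix A :: "('s, 'm, 'r) local_algorithm" and M R and D :: nat
        assume apx: "approximates_within unweighted_tap edge_count \<alpha> A M R"
          and D: "max N (nat \<lceil>2 / (1 - 1 / c) + 1\<rceil>) \<le> D"
        have "\<alpha> (4 * D) < (real (4 * D) - 1) / (2 * c)"
          using D by (intro N) simp
        moreover have "2 / (1 - 1 / c) + 1 \<le> real D"
          using D by linarith
        ultimately show "\<exists>I. unweighted_tap I \<and> diameter_of I = D \<and>
              (1 - 1 / c) / 2 * real D \<le> real (R I)"
          using \<alpha> by (intro unweighted_lower_bound[OF apx _ c]) auto
      qed
    qed
  qed
qed

end
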